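(* Let $0<\alpha<1$ and $m\ge 1$. Let $\mathcal D_{\mathrm{dev}}$ be development information, let $H_1,\dots,H_m$ be calibration documents and $X$ a new null document (each augmented with its own random seed if there is randomization, under the same per-document randomization scheme for calibration and test documents), and suppose that, conditional on $\mathcal D_{\mathrm{dev}}$, the $m+1$ (augmented) documents $H_1,\dots,H_m,X$ are exchangeable. Let $\pi$ be a measurable finite-horizon route generator, $(S_a)$ measurable score maps and $(g_a)$ measurable transformations, all fixed using $\mathcal D_{\mathrm{dev}}$ and without use of $H_1,\dots,H_m$ or their summaries. For a document $x$ let $a_1(x),\dots,a_{T_\pi(x)}(x)$ be its complete route under $\pi$, and let $$M_\pi(x)=\max_{1\le t\le T_\pi(x)}g_{a_t(x)}\{S_{a_t(x)}(x)\},\qquad M_{\pi,t}(x)=\max_{1\le s\le t}g_{a_s(x)}\{S_{a_s(x)}(x)\},$$ with $M_\pi(x)=-\infty$ if the route is empty. For $1\le t\le T_\pi(X)$ put $$p_t^{\mathrm{path}}(X)=\frac{1+\sum_{i=1}^m\mathbf 1\{M_\pi(H_i)\ge M_{\pi,t}(X)\}}{m+1}.$$ Suppose that deployment executes the first $\tau$ actions of the route of $X$, where $0\le\tau\le T_\pi(X)$ is an arbitrary (measurable) early-termination index, which may depend on the calibration documents and on the observations; an alert occurs if and only if $p_t^{\mathrm{path}}(X)\le\alpha$ for some executed action $1\le t\le\tau$ (no alert if $\tau=0$). Then $$\mathbb P_0\{\text{an alert occurs at any executed action}\}\le\alpha .$$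
   Context: A document is a random element (a finite token sequence, including its length and acquisition metadata) of a measurable space; no assumption is made on dependence between tokens within a document. An action is a choice of inspection extent (prefix of the document) and detector, and $S_a(x)$, with values in the extended real line, is the score of document $x$ under action $a$. A route generator $\pi$ is a rule which, given a document (and its seed), successively selects actions $a_1(x),a_2(x),\dots$, each chosen as a function of document features and the scores observed so far, and ends at a planned terminal index $T_\pi(x)\in\{0,1,2,\dots\}$ bounded by a finite horizon. The complete route is obtained by running $\pi$ to $T_\pi(x)$ with alert-based stopping disabled (futility rules that are part of $\pi$, fixed from $\mathcal D_{\mathrm{dev}}$, are retained). The transformations $g_a$ take values in the extended reals; a failed action has score $-\infty$ and $g_a(-\infty)=-\infty$. "Fixed using $\mathcal D_{\mathrm{dev}}$" means deterministic conditional on $\mathcal D_{\mathrm{dev}}$. Calibration information may influence only when deployment terminates, not the next action, the transformation or the seed, so the executed actions are always an initial segment of the complete route of $X$. Per-document randomization is symmetric: each document carries its own seed (e.g. independent seeds from a common distribution, independent of the documents), and the same fixed map $M_\pi$ is applied to all augmented documents. $\mathbb P_0$ denotes the joint null experiment, including the development information, the calibration documents, the new null document and all algorithmic randomness. *)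

theory Defs
  imports "HOL-Probability.Probability"
begin

text \<open>
  The type \<open>'z\<close> is that of documents augmented with their seed.  A route generator reads the
  augmented document and the list of scores observed so far (oldest first); it either halts or
  selects the next action.  The value of \<open>select\<close> is irrelevant where \<open>halts\<close> holds.
\<close>

record ('z, 'a) route_generator =
  select :: "'z \<Rightarrow> ereal list \<Rightarrow> 'a"
  halts :: "'z \<Rightarrow> ereal list \<Rightarrow> bool"

fun scores_seen ::
  "('z, 'a) route_generator \<Rightarrow> ('a \<Rightarrow> 'z \<Rightarrow> ereal) \<Rightarrow> 'z \<Rightarrow> nat \<Rightarrow> ereal list" where
  "scores_seen \<pi> S z 0 = []"
| "scores_seen \<pi> S z (Suc t) =
     scores_seen \<pi> S z t @ [S (select \<pi> z (scores_seen \<pi> S z t)) z]"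

text \<open>Actions are numbered from 1; \<open>route_action\<close> is meaningful for
  \<open>1 \<le> t \<le> route_length \<pi> S z\<close>.\<close>

definition route_action ::
  "('z, 'a) route_generator \<Rightarrow> ('a \<Rightarrow> 'z \<Rightarrow> ereal) \<Rightarrow> 'z \<Rightarrow> nat \<Rightarrow> 'a" where
  "route_action \<pi> S z t = select \<pi> z (scores_seen \<pi> S z (t - 1))"

definition route_length ::
  "('z, 'a) route_generator \<Rightarrow> ('a \<Rightarrow> 'z \<Rightarrow> ereal) \<Rightarrow> 'z \<Rightarrow> nat" where
  "route_length \<pi> S z = (LEAST t. halts \<pi> z (scores_seen \<pi> S z t))"

text \<open>The existential over \<open>t\<close> is what makes the \<open>LEAST\<close> in \<open>route_length\<close> well defined and
  bounded by \<open>N\<close>.\<close>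

definition finite_horizon ::
  "'z measure \<Rightarrow> ('z, 'a) route_generator \<Rightarrow> ('a \<Rightarrow> 'z \<Rightarrow> ereal) \<Rightarrow> bool" where
  "finite_horizon Z \<pi> S \<longleftrightarrow>
     (\<exists>N. \<forall>z\<in>space Z. \<exists>t\<le>N. halts \<pi> z (scores_seen \<pi> S z t))"

text \<open>
  Anything fixed using the development information is a function of its value \<open>d\<close>, and
  measurability is understood jointly in \<open>d\<close> and the remaining arguments.  A history of length
  \<open>n\<close> is a point \<open>h\<close> of the \<open>n\<close>-fold product of the extended real line.
\<close>

definition measurable_route_generator ::
  "'d measure \<Rightarrow> 'z measure \<Rightarrow> 'a measure \<Rightarrow> ('d \<Rightarrow> ('z, 'a) route_generator) \<Rightarrow> bool" where
  "measurable_route_generator Dev Z Act \<pi> \<longleftrightarrow>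
     (\<forall>n. (\<lambda>(d, z, h). select (\<pi> d) z (map h [0..<n]))
             \<in> Dev \<Otimes>\<^sub>M Z \<Otimes>\<^sub>M (\<Pi>\<^sub>M i\<in>{..<n}. (borel :: ereal measure)) \<rightarrow>\<^sub>M Act
        \<and> (\<lambda>(d, z, h). halts (\<pi> d) z (map h [0..<n]))
             \<in> Dev \<Otimes>\<^sub>M Z \<Otimes>\<^sub>M (\<Pi>\<^sub>M i\<in>{..<n}. (borel :: ereal measure)) \<rightarrow>\<^sub>M count_space UNIV)"

definition path_max ::
  "('z, 'a) route_generator \<Rightarrow> ('a \<Rightarrow> 'z \<Rightarrow> ereal) \<Rightarrow> ('a \<Rightarrow> ereal \<Rightarrow> ereal) \<Rightarrow> 'z \<Rightarrow> nat \<Rightarrow> ereal" where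
  "path_max \<pi> S g z t =
     (if t = 0 then -\<infinity>
      else Max ((\<lambda>s. g (route_action \<pi> S z s) (S (route_action \<pi> S z s) z)) ` {1..t}))"

definition complete_max ::
  "('z, 'a) route_generator \<Rightarrow> ('a \<Rightarrow> 'z \<Rightarrow> ereal) \<Rightarrow> ('a \<Rightarrow> ereal \<Rightarrow> ereal) \<Rightarrow> 'z \<Rightarrow> ereal" where
  "complete_max \<pi> S g z = path_max \<pi> S g z (route_length \<pi> S z)"

definition path_pvalue ::
  "('z, 'a) route_generator \<Rightarrow> ('a \<Rightarrow> 'z \<Rightarrow> ereal) \<Rightarrow> ('a \<Rightarrow> ereal \<Rightarrow> ereal)
     \<Rightarrow> nat \<Rightarrow> (nat \<Rightarrow> 'z) \<Rightarrow> 'z \<Rightarrow> nat \<Rightarrow> real" where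
  "path_pvalue \<pi> S g m h x t =
     (1 + (\<Sum>i=1..m. of_bool (complete_max \<pi> S g (h i) \<ge> path_max \<pi> S g x t))) / (real m + 1)"

text \<open>
  Exchangeability of the family \<open>Y\<close>, indexed by \<open>I\<close>, conditional on \<open>D\<close>: all rearrangements have
  the same conditional distribution given the sigma-algebra generated by \<open>D\<close>.  Stated through
  conditional probabilities of events, so no regular conditional distribution has to exist.
\<close>

definition cond_exchangeable ::
  "'w measure \<Rightarrow> 'd measure \<Rightarrow> ('w \<Rightarrow> 'd) \<Rightarrow> 'z measure \<Rightarrow> 'i set \<Rightarrow> ('i \<Rightarrow> 'w \<Rightarrow> 'z) \<Rightarrow> bool" where
  "cond_exchangeable P Dev D Z I Y \<longleftrightarrow>
     (\<forall>\<sigma>. \<sigma> permutes I \<longrightarrow> (\<forall>B\<in>sets (\<Pi>\<^sub>M i\<in>I. Z).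
        AE w in P.
          real_cond_exp P (vimage_algebra (space P) D Dev)
            (\<lambda>w. indicator B (\<lambda>i\<in>I. Y (\<sigma> i) w)) w
          = real_cond_exp P (vimage_algebra (space P) D Dev)
            (\<lambda>w. indicator B (\<lambda>i\<in>I. Y i w)) w))"

end

(*
  The running maximum is dominated by the complete maximum, so an alert at any executed action
  forces the rank of the complete maximum of X among all m + 1 complete maxima (ties counted
  upwards) to be at most alpha (m + 1).  At most alpha (m + 1) of the m + 1 documents can have such
  a rank.  Since the complete maximum is one fixed function of D and the document, exchangeability
  given D makes all of them equally likely to have it.
*)
theory Submission
  imports Defs
begin

section \<open>From conditional exchangeability to invariance of a joint law\<close>

text \<open>Averaging the conditional probabilities over an event that \<open>D\<close> determines
  gives equality on rectangles, and these generate the product sigma-algebra. Keeping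
  \<open>D\<close> as a coordinate of the joint law later allows events whose definition depends on
  \<open>D\<close> as well as on the documents.\<close>

lemma cond_exchangeable_distr_eq:
  assumes "prob_space P" and D: "D \<in> P \<rightarrow>\<^sub>M Dev"
    and Y: "\<And>i. i \<in> I \<Longrightarrow> Y i \<in> P \<rightarrow>\<^sub>M Z"
    and ex: "cond_exchangeable P Dev D Z I Y" and \<sigma>: "\<sigma> permutes I"
  shows "distr P (Dev \<Otimes>\<^sub>M (\<Pi>\<^sub>M i\<in>I. Z)) (\<lambda>w. (D w, \<lambda>i\<in>I. Y (\<sigma> i) w))
       = distr P (Dev \<Otimes>\<^sub>M (\<Pi>\<^sub>M i\<in>I. Z)) (\<lambda>w. (D w, \<lambda>i\<in>I. Y i w))"
proof -
  interpret prob_space P by fact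
  define F where "F = vimage_algebra (space P) D Dev"
  define PZ where "PZ = (\<Pi>\<^sub>M i\<in>I. Z)"
  have sub: "subalgebra P F"
    using D measurable_sets[OF D] unfolding F_def subalgebra_def
    by (auto simp: sets_vimage_algebra2[OF measurable_space[OF D, THEN funcsetI]])
  interpret F: finite_measure_subalgebra P F
    by unfold_locales (rule sub)
  have Y'[measurable]: "(\<lambda>w. \<lambda>i\<in>I. Y i w) \<in> P \<rightarrow>\<^sub>M PZ"
    unfolding PZ_def using Y by (intro measurable_restrict)
  have Y\<sigma>[measurable]: "(\<lambda>w. \<lambda>i\<in>I. Y (\<sigma> i) w) \<in> P \<rightarrow>\<^sub>M PZ"
    unfolding PZ_def using Y permutes_in_image[OF \<sigma>] by (intro measurable_restrict) auto
  note D[measurable]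
  let ?E = "{a \<times> b |a b. a \<in> sets Dev \<and> b \<in> sets PZ}"
  let ?M = "\<lambda>Y'. distr P (Dev \<Otimes>\<^sub>M PZ) (\<lambda>w. (D w, Y' w))"
  have rect: "emeasure (?M (\<lambda>w. \<lambda>i\<in>I. Y (\<sigma> i) w)) (A \<times> B) = emeasure (?M (\<lambda>w. \<lambda>i\<in>I. Y i w)) (A \<times> B)"
    if A: "A \<in> sets Dev" and B: "B \<in> sets PZ" for A B
  proof -
    let ?A = "D -` A \<inter> space P"
    have A_F: "?A \<in> sets F"
      unfolding F_def using A by (rule in_vimage_algebra)
    \<comment> \<open>Here \<open>Y'\<close> is arbitrary so that the formula serves both the
      permuted and the original family. It is the defining property of conditional expectation,
      integrated over the \<open>F\<close>-measurable event \<open>?A\<close>.\<close>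
    have expand: "emeasure (?M Y') (A \<times> B)
        = (\<integral>w\<in>?A. real_cond_exp P F (\<lambda>w. indicator B (Y' w)) w \<partial>P)"
      if Y'[measurable]: "Y' \<in> P \<rightarrow>\<^sub>M PZ" for Y'
    proof -
      have int: "integrable P (\<lambda>w. indicator B (Y' w) :: real)"
        using B by (intro integrable_const_bound[where B = 1]) auto
      have "emeasure (?M Y') (A \<times> B) = emeasure P (?A \<inter> (Y' -` B \<inter> space P))"
        using A B by (subst emeasure_distr) (auto intro!: arg_cong[where f = "emeasure P"])
      also have "\<dots> = measure P (?A \<inter> (Y' -` B \<inter> space P))"
        by (simp add: emeasure_eq_measure)
      also have "measure P (?A \<inter> (Y' -` B \<inter> space P))
          = (\<integral>w. indicator (?A \<inter> (Y' -` B \<inter> space P)) w \<partial>P)"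
        by (auto intro!: arg_cong[where f = "measure P"])
      also have "\<dots> = (\<integral>w\<in>?A. indicator B (Y' w) \<partial>P)"
        unfolding set_lebesgue_integral_def
        by (rule Bochner_Integration.integral_cong) (auto simp: indicator_def)
      also have "\<dots> = (\<integral>w\<in>?A. real_cond_exp P F (\<lambda>w. indicator B (Y' w)) w \<partial>P)"
        by (rule F.real_cond_exp_intA[OF int A_F])
      finally show ?thesis .
    qed
    \<comment> \<open>The exceptional null set may depend on \<open>B\<close>; this is harmless
      because \<open>B\<close> is fixed while integrating.\<close>
    have "AE w in P. real_cond_exp P F (\<lambda>w. indicator B (\<lambda>i\<in>I. Y (\<sigma> i) w)) w
        = real_cond_exp P F (\<lambda>w. indicator B (\<lambda>i\<in>I. Y i w)) w"
      using ex \<sigma> B unfolding cond_exchangeable_def F_def PZ_def by blast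
    then have "(\<integral>w\<in>?A. real_cond_exp P F (\<lambda>w. indicator B (\<lambda>i\<in>I. Y (\<sigma> i) w)) w \<partial>P)
        = (\<integral>w\<in>?A. real_cond_exp P F (\<lambda>w. indicator B (\<lambda>i\<in>I. Y i w)) w \<partial>P)"
      unfolding set_lebesgue_integral_def using A by (intro integral_cong_AE) auto
    then show ?thesis
      by (simp add: expand)
  qed
  \<comment> \<open>Rectangles are closed under intersection, and both laws are finite, so the
    constant sequence of whole spaces serves as the exhausting sequence.\<close>
  show ?thesis
    unfolding PZ_def[symmetric]
  proof (rule measure_eqI_generator_eq[OF Int_stable_pair_measure_generator,
        where A = "\<lambda>_. space Dev \<times> space PZ" and \<Omega> = "space Dev \<times> space PZ"])
    show "?E \<subseteq> Pow (space Dev \<times> space PZ)"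
      by (rule pair_measure_closed)
    show "emeasure (?M (\<lambda>w. \<lambda>i\<in>I. Y (\<sigma> i) w)) (space Dev \<times> space PZ) \<noteq> \<infinity>" for i :: nat
      by (simp add: emeasure_distr emeasure_eq_measure)
    show "emeasure (?M (\<lambda>w. \<lambda>i\<in>I. Y (\<sigma> i) w)) C = emeasure (?M (\<lambda>w. \<lambda>i\<in>I. Y i w)) C"
      if "C \<in> ?E" for C
      using that rect by blast
    show "range (\<lambda>_. space Dev \<times> space PZ) \<subseteq> ?E"
      by blast
  qed (simp_all add: sets_pair_measure)
qed

section \<open>Ranks of exchangeable scores\<close>

text \<open>Among the indices of small rank, the one with the least score is dominated by all of them.\<close>

lemma sum_rank_le:
  fixes v :: "'i \<Rightarrow> 'b::linorder" and c :: real
  assumes I: "finite I" and c: "0 \<le> c"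
  shows "(\<Sum>j\<in>I. of_bool ((\<Sum>i\<in>I. of_bool (v j \<le> v i)) \<le> c)) \<le> c"
proof -
  define J where "J = {j \<in> I. (\<Sum>i\<in>I. of_bool (v j \<le> v i)) \<le> c}"
  have fin: "finite J"
    using I by (simp add: J_def)
  have "real (card J) \<le> c"
  proof (cases "J = {}")
    case False
    define k where "k = arg_min_on v J"
    have k: "k \<in> J" "\<And>j. j \<in> J \<Longrightarrow> v k \<le> v j"
      unfolding k_def using arg_min_if_finite[OF fin False, of v] by (auto simp: not_less)
    have "J \<subseteq> {i \<in> I. v k \<le> v i}"
      using k(2) by (auto simp: J_def)
    then have "real (card J) \<le> (\<Sum>i\<in>I. of_bool (v k \<le> v i))"
      using I by (simp add: card_mono Int_def)
    also have "\<dots> \<le> c"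
      using k(1) by (simp add: J_def)
    finally show ?thesis .
  qed (use c in simp)
  then show ?thesis
    using I by (simp add: J_def Int_def)
qed

text \<open>Swapping two members of the family shows that all of them have the same probability of a
  low rank, while \<open>sum_rank_le\<close> limits how many can have one at the same time. The
  score \<open>V\<close> may depend on \<open>D\<close> because the joint law with \<open>D\<close>
  is invariant.\<close>

lemma cond_exchangeable_rank:
  fixes V :: "'d \<Rightarrow> 'z \<Rightarrow> ereal"
  assumes P: "prob_space P" and D: "D \<in> P \<rightarrow>\<^sub>M Dev"
    and Y: "\<And>i. i \<in> I \<Longrightarrow> Y i \<in> P \<rightarrow>\<^sub>M Z"
    and ex: "cond_exchangeable P Dev D Z I Y"
    and V: "(\<lambda>(d, z). V d z) \<in> Dev \<Otimes>\<^sub>M Z \<rightarrow>\<^sub>M borel"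
    and I: "finite I" "k \<in> I" and \<alpha>: "0 \<le> \<alpha>"
  shows "measure P {w \<in> space P.
      (\<Sum>i\<in>I. of_bool (V (D w) (Y k w) \<le> V (D w) (Y i w))) \<le> \<alpha> * real (card I)} \<le> \<alpha>"
proof -
  interpret prob_space P by fact
  define c where "c = \<alpha> * real (card I)"
  let ?low = "\<lambda>j w. (\<Sum>i\<in>I. of_bool (V (D w) (Y j w) \<le> V (D w) (Y i w))) \<le> c"
  let ?N = "Dev \<Otimes>\<^sub>M (\<Pi>\<^sub>M i\<in>I. Z)"
  \<comment> \<open>The low-rank event of coordinate \<open>k\<close>, as a set in the product
    space, so that the two joint laws can be evaluated on it.\<close>
  define A where "A = {x \<in> space ?N. (\<Sum>i\<in>I. of_bool (V (fst x) (snd x k) \<le> V (fst x) (snd x i))) \<le> c}"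
  note D[measurable]
  have Vm[measurable (raw)]: "(\<lambda>x. V (f x) (h x)) \<in> borel_measurable L"
    if "f \<in> L \<rightarrow>\<^sub>M Dev" "h \<in> L \<rightarrow>\<^sub>M Z" for f h and L :: "'l measure"
    using measurable_compose[OF measurable_Pair[OF that] V] by simp
  have A: "A \<in> sets ?N"
    unfolding A_def of_bool_def using I by measurable
  have low: "{w \<in> space P. ?low j w} \<in> events" if "j \<in> I" for j
    unfolding of_bool_def using I Y that by measurable
  have "prob {w \<in> space P. ?low j w} = prob {w \<in> space P. ?low k w}" if j: "j \<in> I" for j
  proof -
    \<comment> \<open>The transposition puts \<open>Y j\<close> at coordinate \<open>k\<close>, so
      the permuted family lies in \<open>A\<close> exactly when \<open>Y j\<close> has low
      rank.\<close>
    define \<sigma> where "\<sigma> = Transposition.transpose j k"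
    have \<sigma>: "\<sigma> permutes I"
      unfolding \<sigma>_def using I j by (simp add: permutes_swap_id)
    have bij: "bij_betw \<sigma> I I"
      using \<sigma> by (rule permutes_imp_bij)
    have Yr: "(\<lambda>w. (D w, \<lambda>i\<in>I. Y i w)) \<in> P \<rightarrow>\<^sub>M ?N"
      using Y by (intro measurable_Pair measurable_restrict D)
    have Ys: "(\<lambda>w. (D w, \<lambda>i\<in>I. Y (\<sigma> i) w)) \<in> P \<rightarrow>\<^sub>M ?N"
      using Y permutes_in_image[OF \<sigma>] by (intro measurable_Pair measurable_restrict D) auto
    \<comment> \<open>A rank counts over the whole index set, so permuting the competitors leaves it
      unchanged.\<close>
    have "(\<Sum>i\<in>I. of_bool (V (D w) (Y j w) \<le> V (D w) (Y (\<sigma> i) w)))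
        = (\<Sum>i\<in>I. of_bool (V (D w) (Y j w) \<le> V (D w) (Y i w)) :: real)" for w
      by (rule sum.reindex_bij_betw[OF bij])
    then have "{w \<in> space P. ?low j w} = (\<lambda>w. (D w, \<lambda>i\<in>I. Y (\<sigma> i) w)) -` A \<inter> space P"
      using I measurable_space[OF Ys]
      by (auto simp: A_def \<sigma>_def simp del: sum_of_bool_eq cong: sum.cong)
    also have "prob \<dots> = measure (distr P ?N (\<lambda>w. (D w, \<lambda>i\<in>I. Y (\<sigma> i) w))) A"
      using Ys A by (simp add: measure_distr)
    also have "\<dots> = measure (distr P ?N (\<lambda>w. (D w, \<lambda>i\<in>I. Y i w))) A"
      using cond_exchangeable_distr_eq[OF P D Y ex \<sigma>] by simp
    also have "\<dots> = prob ((\<lambda>w. (D w, \<lambda>i\<in>I. Y i w)) -` A \<inter> space P)"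
      using Yr A by (simp add: measure_distr)
    also have "(\<lambda>w. (D w, \<lambda>i\<in>I. Y i w)) -` A \<inter> space P = {w \<in> space P. ?low k w}"
      using I measurable_space[OF Yr]
      by (auto simp: A_def simp del: sum_of_bool_eq cong: sum.cong)
    finally show ?thesis .
  qed
  \<comment> \<open>Double counting: \<open>card I\<close> equal probabilities add up to the
    expected number of low-rank members, which is at most \<open>c\<close> pointwise.\<close>
  then have "real (card I) * prob {w \<in> space P. ?low k w}
      = (\<Sum>j\<in>I. prob {w \<in> space P. ?low j w})"
    by simp
  also have "\<dots> = (\<Sum>j\<in>I. expectation (indicator {w \<in> space P. ?low j w}))"
    using low by (intro sum.cong refl) (auto intro!: arg_cong[where f = prob])
  also have "\<dots> = expectation (\<lambda>w. \<Sum>j\<in>I. indicator {w \<in> space P. ?low j w} w)"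
    using low by (subst Bochner_Integration.integral_sum) (auto simp: emeasure_eq_measure)
  also have "\<dots> \<le> expectation (\<lambda>w. c)"
  proof (rule integral_mono)
    fix w assume "w \<in> space P"
    then show "(\<Sum>j\<in>I. indicator {w \<in> space P. ?low j w} w) \<le> c"
      using sum_rank_le[OF I(1), of c "\<lambda>i. V (D w) (Y i w)"] \<alpha>
      by (simp add: indicator_def of_bool_def c_def)
  qed (use low in \<open>auto simp: emeasure_eq_measure\<close>)
  also have "\<dots> = real (card I) * \<alpha>"
    by (simp add: c_def prob_space)
  finally have "real (card I) * prob {w \<in> space P. ?low k w} \<le> real (card I) * \<alpha>" .
  moreover have "0 < card I"
    using I by (auto simp: card_gt_0_iff)
  ultimately show ?thesis
    unfolding c_def by (simp only: mult_le_cancel_left_pos of_nat_0_less_iff)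
qed

section \<open>Monotonicity along a route\<close>

lemma path_max_mono:
  assumes "s \<le> t"
  shows "path_max \<pi> S g z s \<le> path_max \<pi> S g z t"
proof (cases "s = 0")
  case False
  then show ?thesis
    using assms by (auto simp: path_max_def intro!: Max_mono)
qed (simp add: path_max_def)

text \<open>Raising the running maximum can only reduce the number of calibration maxima that reach
  it. Hence a crossing of the level at any step persists to the end of the route, which is why an
  arbitrary early-termination rule is harmless.\<close>

lemma path_pvalue_antimono:
  assumes "s \<le> t"
  shows "path_pvalue \<pi> S g m h x t \<le> path_pvalue \<pi> S g m h x s"
  unfolding path_pvalue_def
  using path_max_mono[OF assms, of \<pi> S g x]
  by (intro divide_right_mono add_left_mono sum_mono) (auto intro: order_trans)

section \<open>Measurability of routes and their maxima\<close>

lemma path_max_Suc: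
  "path_max \<pi> S g z (Suc t) =
     max (path_max \<pi> S g z t)
       (g (route_action \<pi> S z (Suc t)) (S (route_action \<pi> S z (Suc t)) z))"
proof (cases "t = 0")
  case False
  then show ?thesis
    by (simp add: path_max_def atLeastAtMostSuc_conv max.commute)
qed (simp add: path_max_def)

text \<open>Bridge between the recursively built history and a point of a product space, the form in
  which route generators are assumed measurable. List positions start at 0 and actions at 1, hence
  \<open>Suc i\<close>.\<close>

lemma scores_seen_eq_map:
  "scores_seen \<pi> S z t = map (\<lambda>i. S (route_action \<pi> S z (Suc i)) z) [0..<t]"
  by (induction t) (auto simp: route_action_def)

context
  fixes Dev :: "'d measure" and Z :: "'z measure" and Act :: "'a measure"
    and \<pi> :: "'d \<Rightarrow> ('z, 'a) route_generator"
    and S :: "'d \<Rightarrow> 'a \<Rightarrow> 'z \<Rightarrow> ereal"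
  assumes \<pi>: "measurable_route_generator Dev Z Act \<pi>"
    and S: "(\<lambda>(d, a, z). S d a z) \<in> Dev \<Otimes>\<^sub>M Act \<Otimes>\<^sub>M Z \<rightarrow>\<^sub>M borel"
begin

text \<open>The hypothesis concerns only the first \<open>t\<close> actions, so that the lemma can
  be applied inside the strong induction for \<open>measurable_route_action\<close>.\<close>

lemma measurable_history:
  assumes "\<And>i. i < t \<Longrightarrow> (\<lambda>(d, z). route_action (\<pi> d) (S d) z (Suc i)) \<in> Dev \<Otimes>\<^sub>M Z \<rightarrow>\<^sub>M Act"
  shows "(\<lambda>(d, z). (d, z, \<lambda>i\<in>{..<t}. S d (route_action (\<pi> d) (S d) z (Suc i)) z))
    \<in> Dev \<Otimes>\<^sub>M Z \<rightarrow>\<^sub>M Dev \<Otimes>\<^sub>M Z \<Otimes>\<^sub>M (\<Pi>\<^sub>M i\<in>{..<t}. borel)"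
proof -
  have "(\<lambda>(d, z). S d (route_action (\<pi> d) (S d) z (Suc i)) z) \<in> borel_measurable (Dev \<Otimes>\<^sub>M Z)"
    if "i < t" for i
  proof -
    have "(\<lambda>(d, z). (d, route_action (\<pi> d) (S d) z (Suc i), z))
        \<in> Dev \<Otimes>\<^sub>M Z \<rightarrow>\<^sub>M Dev \<Otimes>\<^sub>M Act \<Otimes>\<^sub>M Z"
      using assms[OF that] by (simp add: case_prod_beta')
    from measurable_compose[OF this S] show ?thesis
      by (simp add: case_prod_beta')
  qed
  then show ?thesis
    by (auto simp: case_prod_beta' intro!: measurable_Pair measurable_restrict)
qed

lemma history_eq:
  "map (\<lambda>i\<in>{..<t}. S d (route_action (\<pi> d) (S d) z (Suc i)) z) [0..<t]
    = scores_seen (\<pi> d) (S d) z t"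
  by (simp add: scores_seen_eq_map)

text \<open>Action \<open>Suc t\<close> is \<open>select\<close> composed with the history of the
  first \<open>t\<close> scores, which is measurable by the induction hypothesis. Since
  \<open>route_action\<close> is total, positions beyond the halting time are covered without a case
  split.\<close>

lemma measurable_route_action:
  "(\<lambda>(d, z). route_action (\<pi> d) (S d) z (Suc t)) \<in> Dev \<Otimes>\<^sub>M Z \<rightarrow>\<^sub>M Act"
proof (induction t rule: less_induct)
  case (less t)
  have "(\<lambda>(d, z, h). select (\<pi> d) z (map h [0..<t]))
      \<in> Dev \<Otimes>\<^sub>M Z \<Otimes>\<^sub>M (\<Pi>\<^sub>M i\<in>{..<t}. borel) \<rightarrow>\<^sub>M Act"
    using \<pi> by (simp add: measurable_route_generator_def)
  from measurable_compose[OF measurable_history[OF less] this]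
  have "(\<lambda>(d, z). select (\<pi> d) z (scores_seen (\<pi> d) (S d) z t)) \<in> Dev \<Otimes>\<^sub>M Z \<rightarrow>\<^sub>M Act"
    by (simp add: case_prod_beta' history_eq)
  then show ?case
    by (simp add: route_action_def)
qed

lemma measurable_halts:
  "(\<lambda>(d, z). halts (\<pi> d) z (scores_seen (\<pi> d) (S d) z t)) \<in> Dev \<Otimes>\<^sub>M Z \<rightarrow>\<^sub>M count_space UNIV"
proof -
  have "(\<lambda>(d, z, h). halts (\<pi> d) z (map h [0..<t]))
      \<in> Dev \<Otimes>\<^sub>M Z \<Otimes>\<^sub>M (\<Pi>\<^sub>M i\<in>{..<t}. borel) \<rightarrow>\<^sub>M count_space UNIV"
    using \<pi> by (simp add: measurable_route_generator_def)
  from measurable_compose[OF measurable_history[OF measurable_route_action] this] show ?thesis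
    by (simp add: case_prod_beta' history_eq)
qed

lemma measurable_route_length:
  "(\<lambda>(d, z). route_length (\<pi> d) (S d) z) \<in> Dev \<Otimes>\<^sub>M Z \<rightarrow>\<^sub>M count_space UNIV"
  unfolding route_length_def case_prod_beta'
  using measurable_halts by (intro measurable_Least) (simp add: case_prod_beta')

lemma measurable_path_max:
  assumes g: "(\<lambda>(d, a, s). g d a s) \<in> Dev \<Otimes>\<^sub>M Act \<Otimes>\<^sub>M borel \<rightarrow>\<^sub>M borel"
  shows "(\<lambda>(d, z). path_max (\<pi> d) (S d) (g d) z t) \<in> borel_measurable (Dev \<Otimes>\<^sub>M Z)"
proof (induction t)
  case (Suc t)
  let ?a = "\<lambda>x. route_action (\<pi> (fst x)) (S (fst x)) (snd x) (Suc t)"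
  have a[measurable]: "?a \<in> Dev \<Otimes>\<^sub>M Z \<rightarrow>\<^sub>M Act"
    using measurable_route_action by (simp add: case_prod_beta')
  have "(\<lambda>x. S (fst x) (?a x) (snd x)) \<in> borel_measurable (Dev \<Otimes>\<^sub>M Z)"
    using measurable_compose[OF _ S, of "\<lambda>x. (fst x, ?a x, snd x)"] by simp
  then have "(\<lambda>x. g (fst x) (?a x) (S (fst x) (?a x) (snd x))) \<in> borel_measurable (Dev \<Otimes>\<^sub>M Z)"
    using measurable_compose[OF _ g, of "\<lambda>x. (fst x, ?a x, S (fst x) (?a x) (snd x))"] by simp
  with Suc show ?case
    by (simp add: path_max_Suc case_prod_beta')
qed (simp add: path_max_def)

text \<open>The terminal index varies with \<open>d\<close> and \<open>z\<close> but takes countably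
  many values, so measurability of the running maximum at each fixed index suffices.\<close>

lemma measurable_complete_max:
  assumes g: "(\<lambda>(d, a, s). g d a s) \<in> Dev \<Otimes>\<^sub>M Act \<Otimes>\<^sub>M borel \<rightarrow>\<^sub>M borel"
  shows "(\<lambda>(d, z). complete_max (\<pi> d) (S d) (g d) z) \<in> borel_measurable (Dev \<Otimes>\<^sub>M Z)"
  unfolding complete_max_def case_prod_beta'
  by (rule measurable_compose_countable
      [OF measurable_path_max[OF g, unfolded case_prod_beta']
          measurable_route_length[unfolded case_prod_beta']])

end

section \<open>The bound on the alert probability\<close>

theorem theorem5p1:
  fixes P :: "'w measure"
    and Dev :: "'d measure" and Doc :: "'x measure" and Seed :: "'u measure"
    and Act :: "'a measure"
    and D :: "'w \<Rightarrow> 'd"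
    and H :: "nat \<Rightarrow> 'w \<Rightarrow> 'x \<times> 'u" and X :: "'w \<Rightarrow> 'x \<times> 'u"
    and \<pi> :: "'d \<Rightarrow> ('x \<times> 'u, 'a) route_generator"
    and S :: "'d \<Rightarrow> 'a \<Rightarrow> 'x \<times> 'u \<Rightarrow> ereal"
    and g :: "'d \<Rightarrow> 'a \<Rightarrow> ereal \<Rightarrow> ereal"
    and \<tau> :: "'w \<Rightarrow> nat"
    and m :: nat and \<alpha> :: real
  assumes "prob_space P"
    and "0 < \<alpha>" "\<alpha> < 1" "m \<ge> 1"
    and "D \<in> P \<rightarrow>\<^sub>M Dev"
    and "\<And>i. i \<in> {1..m} \<Longrightarrow> H i \<in> P \<rightarrow>\<^sub>M Doc \<Otimes>\<^sub>M Seed"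
    and "X \<in> P \<rightarrow>\<^sub>M Doc \<Otimes>\<^sub>M Seed"
    and "cond_exchangeable P Dev D (Doc \<Otimes>\<^sub>M Seed) {1..m + 1} (H(m + 1 := X))"
    and "measurable_route_generator Dev (Doc \<Otimes>\<^sub>M Seed) Act \<pi>"
    and "\<And>d. d \<in> space Dev \<Longrightarrow> finite_horizon (Doc \<Otimes>\<^sub>M Seed) (\<pi> d) (S d)"
    and "(\<lambda>(d, a, z). S d a z) \<in> Dev \<Otimes>\<^sub>M Act \<Otimes>\<^sub>M (Doc \<Otimes>\<^sub>M Seed) \<rightarrow>\<^sub>M borel"
    and "(\<lambda>(d, a, s). g d a s) \<in> Dev \<Otimes>\<^sub>M Act \<Otimes>\<^sub>M borel \<rightarrow>\<^sub>M borel"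
    and "\<And>d a. d \<in> space Dev \<Longrightarrow> a \<in> space Act \<Longrightarrow> g d a (-\<infinity>) = -\<infinity>"
    and "\<tau> \<in> P \<rightarrow>\<^sub>M count_space UNIV"
    and "\<And>w. w \<in> space P \<Longrightarrow> \<tau> w \<le> route_length (\<pi> (D w)) (S (D w)) (X w)"
  defines "alert \<equiv> {w \<in> space P. \<exists>t\<in>{1..\<tau> w}.
      path_pvalue (\<pi> (D w)) (S (D w)) (g (D w)) m (\<lambda>i. H i w) (X w) t \<le> \<alpha>}"
  shows "alert \<in> sets P \<and> measure P alert \<le> \<alpha>"
proof -
  interpret prob_space P by fact
  note \<open>D \<in> P \<rightarrow>\<^sub>M Dev\<close>[measurable] \<open>X \<in> P \<rightarrow>\<^sub>M Doc \<Otimes>\<^sub>M Seed\<close>[measurable]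
    \<open>\<tau> \<in> P \<rightarrow>\<^sub>M count_space UNIV\<close>[measurable]
  let ?I = "{1..m + 1}" and ?Y = "H(m + 1 := X)"
  let ?C = "\<lambda>w z. complete_max (\<pi> (D w)) (S (D w)) (g (D w)) z"
  let ?M = "\<lambda>w t. path_max (\<pi> (D w)) (S (D w)) (g (D w)) (X w) t"
  have Y: "?Y i \<in> P \<rightarrow>\<^sub>M Doc \<Otimes>\<^sub>M Seed" if "i \<in> ?I" for i
    using that assms(6,7) by auto
  have C: "(\<lambda>(d, z). complete_max (\<pi> d) (S d) (g d) z) \<in> borel_measurable (Dev \<Otimes>\<^sub>M (Doc \<Otimes>\<^sub>M Seed))"
    by (rule measurable_complete_max) fact+
  have M: "(\<lambda>(d, z). path_max (\<pi> d) (S d) (g d) z t) \<in> borel_measurable (Dev \<Otimes>\<^sub>M (Doc \<Otimes>\<^sub>M Seed))" for t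
    by (rule measurable_path_max) fact+
  have [measurable]: "(\<lambda>w. ?C w (Z w)) \<in> borel_measurable P" if "Z \<in> P \<rightarrow>\<^sub>M Doc \<Otimes>\<^sub>M Seed" for Z
    using measurable_compose[OF measurable_Pair[OF \<open>D \<in> P \<rightarrow>\<^sub>M Dev\<close> that] C] by simp
  have [measurable]: "(\<lambda>w. ?M w t) \<in> borel_measurable P" for t
    using measurable_compose[OF measurable_Pair[OF \<open>D \<in> P \<rightarrow>\<^sub>M Dev\<close> \<open>X \<in> _\<close>] M] by simp
  have [measurable]: "(\<lambda>w. path_pvalue (\<pi> (D w)) (S (D w)) (g (D w)) m (\<lambda>i. H i w) (X w) t)
      \<in> borel_measurable P" for t
    unfolding path_pvalue_def of_bool_def using assms(6) by measurable
  \<comment> \<open>A union over deterministic \<open>t\<close> removes the random bound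
    \<open>\<tau> w\<close> from the index range, leaving countably many measurable events.\<close>
  have "alert = (\<Union>t\<in>{1..}. {w \<in> space P. t \<le> \<tau> w \<and>
      path_pvalue (\<pi> (D w)) (S (D w)) (g (D w)) m (\<lambda>i. H i w) (X w) t \<le> \<alpha>})"
    by (auto simp: alert_def)
  also have "\<dots> \<in> events"
    by measurable
  finally have "alert \<in> events" .
  \<comment> \<open>The event that the complete maximum of \<open>X\<close>, stored at index
    \<open>m + 1\<close>, has low rank among all \<open>m + 1\<close> complete maxima. It does not
    involve \<open>\<tau>\<close>.\<close>
  let ?R = "{w \<in> space P. (\<Sum>i\<in>?I. of_bool (?C w (?Y (m + 1) w) \<le> ?C w (?Y i w))) \<le> \<alpha> * real (card ?I)}"
  have "alert \<subseteq> ?R"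
  proof
    fix w assume "w \<in> alert"
    then obtain t where w: "w \<in> space P" and t: "1 \<le> t" "t \<le> \<tau> w"
      and "path_pvalue (\<pi> (D w)) (S (D w)) (g (D w)) m (\<lambda>i. H i w) (X w) t \<le> \<alpha>"
      by (auto simp: alert_def)
    moreover have "t \<le> route_length (\<pi> (D w)) (S (D w)) (X w)"
      using t assms(15)[OF w] by simp
    \<comment> \<open>As \<open>t\<close> does not exceed the route length, the crossing carries
      over to the terminal step, where the running maximum is \<open>complete_max\<close> of
      \<open>X\<close>.\<close>
    ultimately have "path_pvalue (\<pi> (D w)) (S (D w)) (g (D w)) m (\<lambda>i. H i w) (X w)
        (route_length (\<pi> (D w)) (S (D w)) (X w)) \<le> \<alpha>"
      by (meson path_pvalue_antimono order_trans)
    then have "1 + (\<Sum>i=1..m. of_bool (?C w (X w) \<le> ?C w (H i w))) \<le> \<alpha> * (real m + 1)"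
      unfolding path_pvalue_def complete_max_def[symmetric]
      by (subst (asm) pos_divide_le_eq) simp_all
    \<comment> \<open>The added 1 in the numerator of the p-value is the term
      \<open>i = m + 1\<close>, in which \<open>X\<close> is compared with itself; likewise the
      denominator is \<open>card ?I\<close>.\<close>
    moreover have "(\<Sum>i\<in>?I. of_bool (?C w (?Y (m + 1) w) \<le> ?C w (?Y i w)))
        = 1 + (\<Sum>i=1..m. of_bool (?C w (X w) \<le> ?C w (H i w)) :: real)"
      by simp
    ultimately show "w \<in> ?R"
      using w by (simp add: add.commute)
  qed
  moreover have "?R \<in> events"
    unfolding of_bool_def using Y by measurable
  ultimately have "prob alert \<le> prob ?R"
    by (rule finite_measure_mono)
  also have "\<dots> \<le> \<alpha>"
    by (rule cond_exchangeable_rank[OF \<open>prob_space P\<close> assms(5) Y assms(8) C])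
      (use \<open>0 < \<alpha>\<close> in auto)
  finally show ?thesis
    using \<open>alert \<in> events\<close> by simp
qed

end
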